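(* For every connected graph $G$ of order $n$ and minimum degree $\delta$, $$ rc(G) \leq \frac{3n}{\delta + 1} + 3. $$ Moreover, for every $\delta \geq 2$, there exist infinitely many connected graphs $G$ of minimum degree $\delta$ and order $n$ such that $rc(G) \geq \frac{3(n-2)}{\delta + 1} - 1$.
   Context: Graphs are finite and simple. An edge-coloured graph is rainbow connected if every pair of vertices is joined by a path no two of whose edges have the same colour; the rainbow connection number $rc(G)$ of a connected graph $G$ is the minimum number of colours in an edge colouring making $G$ rainbow connected. *)

theory Defs
  imports Complex_Main "Graph_Theory.Digraph_Isomorphism"
begin

text \<open>
  Finite simple graphs are the loop-free symmetric digraphs without parallel arcs of the
  locale \<^locale>\<open>graph\<close>. Each undirected edge corresponds to two opposite arcs.
  Colourings are therefore taken on the unordered pairs of ends, so that opposite arcs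
  share a colour.
\<close>

definition uedge :: "('a, 'b) pre_digraph \<Rightarrow> 'b \<Rightarrow> 'a set" where
  "uedge G a = {tail G a, head G a}"

definition uedges :: "('a, 'b) pre_digraph \<Rightarrow> 'a set set" where
  "uedges G = uedge G ` arcs G"

text \<open>In a symmetric digraph without parallel arcs, out-degree is the number of neighbours.\<close>

definition min_degree :: "('a, 'b) pre_digraph \<Rightarrow> nat" where
  "min_degree G = Min (out_degree G ` verts G)"

definition rainbow_path ::
  "('a, 'b) pre_digraph \<Rightarrow> ('a set \<Rightarrow> 'c) \<Rightarrow> 'a \<Rightarrow> 'b awalk \<Rightarrow> 'a \<Rightarrow> bool" where
  "rainbow_path G c u p v \<longleftrightarrow>
     pre_digraph.apath G u p v \<and> distinct (map (\<lambda>a. c (uedge G a)) p)"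

definition rainbow_connected :: "('a, 'b) pre_digraph \<Rightarrow> ('a set \<Rightarrow> 'c) \<Rightarrow> bool" where
  "rainbow_connected G c \<longleftrightarrow> (\<forall>u \<in> verts G. \<forall>v \<in> verts G. \<exists>p. rainbow_path G c u p v)"

text \<open>
  Natural numbers suffice as colours for a finite graph. For a finite connected graph the
  minimum exists: an injective colouring of the edges makes the graph rainbow connected.
\<close>

definition rc :: "('a, 'b) pre_digraph \<Rightarrow> nat" where
  "rc G = (LEAST k. \<exists>c :: 'a set \<Rightarrow> nat. card (c ` uedges G) = k \<and> rainbow_connected G c)"

end

theory Submission
  imports Defs
begin

text \<open>
  Upper bound for minimum degree \<open>\<delta> \<ge> 2\<close>: grow a connected set \<open>D\<close> from one vertex as long as
  \<open>(|D| + 2) (\<delta> + 1) \<le> 3 |N[D]|\<close> is preserved. A vertex at distance 3 from \<open>D\<close> can be added together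
  with a path to it (3 new vertices, at least \<open>\<delta> + 1\<close> newly dominated), and so can a vertex at
  distance 2 with only one neighbour in \<open>N[D]\<close> (2 new vertices, at least \<open>\<delta>\<close> newly dominated). For a
  maximal \<open>D\<close> every vertex is within distance 2 of \<open>D\<close> and every vertex at distance 2 has two
  neighbours at distance 1. Colour \<open>D\<close> with \<open>|D| - 1\<close> colours, and use six further colours so that any
  two vertices outside \<open>D\<close> have paths into \<open>D\<close> with disjoint sets of colours; this gives
  \<open>rc \<le> |D| + 5\<close>. For \<open>\<delta> \<le> 1\<close> the bound \<open>rc \<le> n\<close> suffices.

  Lower bound: a chain of cliques with consecutive cliques completely joined, of sizes
  \<open>1, \<delta>, 1 | 1, \<delta> - 1, 1 | \<dots> | 1, \<delta> - 1, 1 | 1, \<delta>, 1\<close> with \<open>K \<ge> 2\<close> blocks. It has \<open>K (\<delta> + 1) + 2\<close>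
  vertices and diameter \<open>3 K - 1\<close>, and the rainbow connection number is at least the diameter.
\<close>

section \<open>Coloured walks and two-step domination\<close>

text \<open>Only the colours of a walk are recorded, since rainbowness depends on nothing else.
  Walks suffice because they can later be shortcut to paths.\<close>

inductive cwalk :: "('a \<Rightarrow> 'a \<Rightarrow> bool) \<Rightarrow> ('a \<Rightarrow> 'a \<Rightarrow> 'c) \<Rightarrow> 'a \<Rightarrow> 'c list \<Rightarrow> 'a \<Rightarrow> bool"
  for E f where
  Nil: "cwalk E f u [] u"
| Cons: "E u w \<Longrightarrow> cwalk E f w cs v \<Longrightarrow> cwalk E f u (f u w # cs) v"

lemma cwalk_append:
  "cwalk E f u cs v \<Longrightarrow> cwalk E f v cs' w \<Longrightarrow> cwalk E f u (cs @ cs') w"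
  by (induction rule: cwalk.induct) (auto intro: cwalk.intros)

lemma cwalk_single: "E u v \<Longrightarrow> cwalk E f u [f u v] v"
  by (auto intro: cwalk.intros)

lemma cwalk_rev:
  assumes "\<And>u v. E u v \<Longrightarrow> E v u" and "\<And>u v. f u v = f v u"
  shows "cwalk E f u cs v \<Longrightarrow> cwalk E f v (rev cs) u"
proof (induction rule: cwalk.induct)
  case (Cons u w cs v)
  then have "cwalk E f v (rev cs @ [f w u]) u"
    using assms(1) by (intro cwalk_append[of _ _ v _ w]) (auto intro: cwalk_single)
  then show ?case using assms(2)[of u w] by simp
qed (auto intro: cwalk.intros)

text \<open>Greedy: go through the elements one at a time and keep each that is unrelated to those
  kept so far. Applied below to the linkage relation on \<open>N1\<close>.\<close>

lemma maximal_independent_set: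
  assumes "finite S" and sym: "\<And>x y. R x y \<Longrightarrow> R y x" and irrefl: "\<And>x. \<not> R x x"
  shows "\<exists>A \<subseteq> S. (\<forall>x\<in>A. \<forall>y\<in>A. \<not> R x y) \<and> (\<forall>x\<in>S - A. \<exists>y\<in>A. R x y)"
  using assms(1)
proof induction
  case (insert x S)
  then obtain A where A: "A \<subseteq> S" "\<forall>x\<in>A. \<forall>y\<in>A. \<not> R x y" "\<forall>x\<in>S - A. \<exists>y\<in>A. R x y"
    by blast
  show ?case
  proof (cases "\<exists>y\<in>A. R x y")
    case True
    with A show ?thesis by (intro exI[of _ A]) auto
  next
    case False
    with A sym irrefl show ?thesis by (intro exI[of _ "insert x A"]) blast
  qed
qed simp

text \<open>Lets colourings be built on ordered pairs of ends: \<open>SOME\<close> picks one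
  orientation of the edge, and symmetry makes the choice irrelevant.\<close>

lemma symmetric_edge_function:
  assumes "\<And>u v. f u v = f v u"
  shows "\<exists>c. \<forall>u v. c {u, v} = f u v"
proof -
  define c where "c e = (SOME k. \<exists>u v. e = {u, v} \<and> k = f u v)" for e
  have "c {u, v} = f u v" for u v
  proof -
    have "\<exists>u' v'. {u, v} = {u', v'} \<and> c {u, v} = f u' v'"
      unfolding c_def by (rule someI_ex) blast
    then show ?thesis using assms by (auto simp: doubleton_eq_iff)
  qed
  then show ?thesis by blast
qed

section \<open>Connected sets as grown lists, and the greedy dominating set\<close>

locale adjacency =
  fixes V :: "'a set" and E :: "'a \<Rightarrow> 'a \<Rightarrow> bool"
  assumes finite_V: "finite V"
    and adj_sym: "E u v \<Longrightarrow> E v u"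
    and adj_irrefl: "\<not> E u u"
    and adj_V: "E u v \<Longrightarrow> u \<in> V"
begin

definition nbh :: "'a set \<Rightarrow> 'a set" where
  "nbh S = S \<union> {w. \<exists>d\<in>S. E d w}"

text \<open>
  An enumeration of a connected vertex set in which every vertex has an earlier neighbour.
  Colouring each edge by the larger position of its ends makes the set rainbow connected:
  the end with the larger position steps back to an earlier neighbour, and that colour does
  not occur again.
\<close>

inductive grown :: "'a list \<Rightarrow> bool" where
  single: "u \<in> V \<Longrightarrow> grown [u]"
| snoc: "grown ds \<Longrightarrow> d \<in> set ds \<Longrightarrow> E d x \<Longrightarrow> x \<notin> set ds \<Longrightarrow> grown (ds @ [x])"

lemma grownD: "grown ds \<Longrightarrow> distinct ds \<and> set ds \<subseteq> V \<and> ds \<noteq> []"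
  by (induction rule: grown.induct) (auto dest: adj_V adj_sym)

lemma length_grown: "grown ds \<Longrightarrow> length ds \<le> card V"
  by (metis grownD card_mono distinct_card finite_V)

lemma nbh_subset: "S \<subseteq> V \<Longrightarrow> nbh S \<subseteq> V"
  by (auto simp: nbh_def dest: adj_V adj_sym)

lemma grown_rainbow:
  assumes "grown ds" and fsym: "\<And>u v. f u v = f v u"
    and "\<And>i j. i < length ds \<Longrightarrow> j < length ds \<Longrightarrow> f (ds ! i) (ds ! j) = b + max i j"
    and "u \<in> set ds" "v \<in> set ds"
  shows "\<exists>cs. cwalk E f u cs v \<and> distinct cs \<and> set cs \<subseteq> {b<..<b + length ds}"
  using assms(1,3-)
proof (induction arbitrary: u v rule: grown.induct)
  case (single u)
  then show ?case by (auto intro: cwalk.intros)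
next
  case (snoc ds d x)
  have f_old: "f (ds ! i) (ds ! j) = b + max i j" if "i < length ds" "j < length ds" for i j
    using snoc.prems(1)[of i j] that by (simp add: nth_append)
  have f_new: "f x d = b + length ds"
  proof -
    obtain i where "i < length ds" "d = ds ! i"
      using \<open>d \<in> set ds\<close> by (metis in_set_conv_nth)
    then show ?thesis using snoc.prems(1)[of "length ds" i] by (simp add: nth_append)
  qed
  have from_new: "\<exists>cs. cwalk E f x cs w \<and> distinct cs \<and> set cs \<subseteq> {b<..<b + length (ds @ [x])}"
    if "w \<in> set ds" for w
  proof -
    obtain cs where cs: "cwalk E f d cs w" "distinct cs" "set cs \<subseteq> {b<..<b + length ds}"
      using snoc.IH[OF f_old \<open>d \<in> set ds\<close> \<open>w \<in> set ds\<close>] by blast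
    have "cwalk E f x (f x d # cs) w"
      using cs(1) adj_sym[OF \<open>E d x\<close>] by (rule cwalk.Cons[rotated])
    \<comment> \<open>The fresh colour \<open>b + length ds\<close> must exceed \<open>b\<close>,
      the excluded lower end of the interval, so the old list has to be nonempty.\<close>
    moreover have "0 < length ds" using \<open>d \<in> set ds\<close> by (cases ds) auto
    ultimately show ?thesis using cs f_new
      by (intro exI[of _ "f x d # cs"]) auto
  qed
  consider "u \<in> set ds" "v \<in> set ds" | "u = x" "v \<in> set ds" | "u \<in> set ds" "v = x" | "u = x" "v = x"
    using snoc.prems(2,3) by auto
  then show ?case
  proof cases
    case 1
    with snoc.IH[OF f_old 1] show ?thesis by force
  next
    case 2
    with from_new show ?thesis by blast
  next
    case 3
    then obtain cs where "cwalk E f x cs u" "distinct cs" "set cs \<subseteq> {b<..<b + length (ds @ [x])}"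
      using from_new by blast
    then show ?thesis using cwalk_rev[of E f x cs u, OF adj_sym fsym] 3
      by (intro exI[of _ "rev cs"]) auto
  next
    case 4
    then show ?thesis by (intro exI[of _ "[]"]) (auto intro: cwalk.intros)
  qed
qed

definition position :: "'a list \<Rightarrow> 'a \<Rightarrow> nat" where
  "position ds = the_inv_into {..<length ds} ((!) ds)"

lemma position_nth: "distinct ds \<Longrightarrow> i < length ds \<Longrightarrow> position ds (ds ! i) = i"
  unfolding position_def by (rule the_inv_into_f_f) (auto intro: inj_on_nth)

lemma position_less: "distinct ds \<Longrightarrow> u \<in> set ds \<Longrightarrow> position ds u < length ds"
  by (metis in_set_conv_nth position_nth)

text \<open>A longest grown list exhausts \<open>V\<close>, because an edge leaving it would extend
  it.\<close>

lemma grown_spanning: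
  assumes "V \<noteq> {}"
    and conn: "\<And>S. S \<subseteq> V \<Longrightarrow> S \<noteq> {} \<Longrightarrow> S \<noteq> V \<Longrightarrow> \<exists>p\<in>S. \<exists>q\<in>V - S. E p q"
  shows "\<exists>ds. grown ds \<and> set ds = V"
proof -
  obtain u where "u \<in> V" using assms(1) by blast
  then have "grown [u]" by (rule grown.single)
  moreover have "\<forall>ds. grown ds \<longrightarrow> length ds < Suc (card V)" using length_grown by (simp add: less_Suc_eq_le)
  ultimately obtain ds where ds: "grown ds" "\<And>ds'. grown ds' \<Longrightarrow> length ds' \<le> length ds"
    using ex_has_greatest_nat[of grown "[u]" length] by blast
  have "set ds = V"
  proof (rule ccontr)
    assume "set ds \<noteq> V"
    then obtain p q where "p \<in> set ds" "q \<in> V - set ds" "E p q"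
      using conn[of "set ds"] grownD[OF ds(1)] by auto
    then have "grown (ds @ [q])" using ds(1) by (auto intro: grown.snoc)
    then show False using ds(2) by fastforce
  qed
  with ds(1) show ?thesis by blast
qed

lemma greedy_two_step_dominating:
  assumes "V \<noteq> {}"
    and conn: "\<And>S. S \<subseteq> V \<Longrightarrow> S \<noteq> {} \<Longrightarrow> S \<noteq> V \<Longrightarrow> \<exists>p\<in>S. \<exists>q\<in>V - S. E p q"
    and deg: "\<And>v. v \<in> V \<Longrightarrow> \<delta> \<le> card {w. E v w}" and "2 \<le> \<delta>"
  shows "\<exists>ds. grown ds \<and> (length ds + 2) * (\<delta> + 1) \<le> 3 * card V \<and>
    (\<forall>v\<in>V - nbh (set ds). \<forall>x. \<exists>y\<in>nbh (set ds). E v y \<and> y \<noteq> x)"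
proof -
  define P where "P ds \<longleftrightarrow> grown ds \<and> (length ds + 2) * (\<delta> + 1) \<le> 3 * card (nbh (set ds))" for ds
  have fin_nbs: "finite {w. E v w}" for v
    by (rule finite_subset[OF _ finite_V]) (auto dest: adj_V adj_sym)
  have card_nbh1: "\<delta> + 1 \<le> card (nbh {v})" if "v \<in> V" for v
  proof -
    have "nbh {v} = insert v {w. E v w}" by (auto simp: nbh_def)
    then show ?thesis using deg[OF that] fin_nbs[of v] adj_irrefl[of v] by simp
  qed
  obtain u where "u \<in> V" using assms(1) by blast
  \<comment> \<open>The summand 2 in \<open>P\<close> is the largest for which a single vertex
    qualifies by its degree alone: (1 + 2)(\<delta> + 1) \<le> 3 |N[u]|.\<close>
  then have "P [u]" using card_nbh1[of u] by (simp add: P_def grown.single)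
  moreover have "\<forall>ds. P ds \<longrightarrow> length ds < Suc (card V)"
    using length_grown by (simp add: less_Suc_eq_le P_def)
  ultimately obtain ds where ds: "P ds" "\<And>ds'. P ds' \<Longrightarrow> length ds' \<le> length ds"
    using ex_has_greatest_nat[of P "[u]" length] by blast
  define D where "D = set ds"
  have g: "grown ds" and size: "(length ds + 2) * (\<delta> + 1) \<le> 3 * card (nbh D)"
    using ds(1) by (auto simp: P_def D_def)
  have DV: "D \<subseteq> V" using grownD[OF g] by (simp add: D_def)
  \<comment> \<open>Each added vertex raises the left side of \<open>P\<close> by \<delta> + 1 and
    each newly dominated one raises the right side by 3, so an affordable extension contradicts
    maximality.\<close>
  have no_extension: False
    if "grown (ds @ xs)" "xs \<noteq> []" "T \<subseteq> nbh (set (ds @ xs))" "T \<inter> nbh D = {}"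
      "length xs * (\<delta> + 1) \<le> 3 * card T" for xs T
  proof -
    have "nbh D \<subseteq> nbh (set (ds @ xs))" by (auto simp: nbh_def D_def)
    moreover have sub: "nbh (set (ds @ xs)) \<subseteq> V" using grownD[OF that(1)] nbh_subset by blast
    ultimately have "card (nbh D \<union> T) \<le> card (nbh (set (ds @ xs)))"
      using that(3) finite_V by (intro card_mono) (auto intro: finite_subset)
    moreover have "card (nbh D \<union> T) = card (nbh D) + card T"
      using that(3,4) sub nbh_subset[OF DV] finite_V
      by (intro card_Un_disjoint) (auto intro: finite_subset)
    ultimately have "P (ds @ xs)" using size that(1,5) by (simp add: P_def algebra_simps)
    then show False using ds(2) that(2) by fastforce
  qed
  \<comment> \<open>Otherwise some edge leads from \<open>p\<close> at distance 2 from
    \<open>D\<close> to \<open>q\<close> at distance 3. Adding \<open>x\<close>, \<open>p\<close>,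
    \<open>q\<close> costs 3 (\<delta> + 1), which is paid for by the closed neighbourhood of
    \<open>q\<close>, since it is disjoint from that of \<open>D\<close>.\<close>
  have cover: "nbh (nbh D) = V"
  proof (rule ccontr)
    assume "nbh (nbh D) \<noteq> V"
    moreover have "nbh (nbh D) \<subseteq> V" using nbh_subset DV by blast
    moreover have "nbh (nbh D) \<noteq> {}" using grownD[OF g] by (auto simp: nbh_def D_def)
    ultimately obtain p q where pq: "p \<in> nbh (nbh D)" "q \<in> V" "q \<notin> nbh (nbh D)" "E p q"
      using conn by blast
    have "p \<notin> nbh D" using pq by (auto simp: nbh_def)
    then obtain x d where x: "x \<notin> D" "E x p" "d \<in> D" "E d x"
      using pq(1) unfolding nbh_def by blast
    have "grown (ds @ [x])" using g x by (auto simp: D_def intro: grown.snoc)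
    then have "grown ((ds @ [x]) @ [p])"
      by (rule grown.snoc[of _ x])
        (use x \<open>p \<notin> nbh D\<close> adj_irrefl in \<open>auto simp: D_def nbh_def\<close>)
    then have "grown (((ds @ [x]) @ [p]) @ [q])"
      by (rule grown.snoc[of _ p])
        (use pq x \<open>p \<notin> nbh D\<close> adj_irrefl in \<open>auto simp: D_def nbh_def\<close>)
    then have "grown (ds @ [x, p, q])" by simp
    moreover have "nbh {q} \<inter> nbh D = {}"
      using pq(3) adj_sym unfolding nbh_def by blast
    ultimately show False
      using no_extension[of "[x, p, q]" "nbh {q}"] card_nbh1[OF pq(2)]
      by (auto simp: nbh_def)
  qed
  have "\<exists>y\<in>nbh D. E v y \<and> y \<noteq> x" if v: "v \<in> V" "v \<notin> nbh D" for v x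
  proof (rule ccontr)
    assume no: "\<not> ?thesis"
    obtain z where z: "z \<in> nbh D" "E v z"
      using cover v adj_sym unfolding nbh_def by blast
    with no have "z = x" by blast
    obtain d where d: "d \<in> D" "E d z" "z \<notin> D"
      using z v adj_sym unfolding nbh_def by blast
    \<comment> \<open>\<open>z\<close> is the only neighbour of \<open>v\<close> in
      \<open>nbh D\<close>, so all of \<open>T\<close> is newly dominated when \<open>z\<close> and
      \<open>v\<close> are added. The price is covered because 2 (\<delta> + 1) \<le> 3 \<delta> for
      \<delta> \<ge> 2.\<close>
    define T where "T = nbh {v} - {z}"
    have "grown (ds @ [z])" using g d by (auto simp: D_def intro: grown.snoc)
    then have "grown ((ds @ [z]) @ [v])"
      by (rule grown.snoc[of _ z]) (use z v adj_sym adj_irrefl in \<open>auto simp: D_def nbh_def\<close>)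
    then have "grown (ds @ [z, v])" by simp
    moreover have "T \<inter> nbh D = {}" using no v \<open>z = x\<close> by (auto simp: T_def nbh_def)
    moreover have "\<delta> \<le> card T"
    proof -
      have "finite (nbh {v})" using fin_nbs[of v] by (auto simp: nbh_def)
      then show ?thesis using card_nbh1[OF v(1)]
        by (auto simp: T_def card_Diff_singleton_if)
    qed
    ultimately show False
      using no_extension[of "[z, v]" T] \<open>2 \<le> \<delta>\<close> by (auto simp: T_def nbh_def)
  qed
  moreover have "card (nbh D) \<le> card V" using nbh_subset[OF DV] finite_V by (rule card_mono[rotated])
  ultimately show ?thesis using g size unfolding D_def by (intro exI[of _ ds]) auto
qed

end

section \<open>A colouring from a two-step dominating set\<close>

text \<open>
  \<open>N1\<close> and \<open>N2\<close> are the vertices at distance 1 and 2 from \<open>D\<close>. The maximal independent set \<open>A\<close> of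
  the linkage graph splits \<open>N1\<close> into two labels such that a linked vertex is linked to one of the
  opposite label.
\<close>

locale two_step = adjacency +
  fixes ds :: "'a list" and A :: "'a set" and foot :: "'a \<Rightarrow> 'a" and up :: "'a \<Rightarrow> 'a"
    and D N1 N2 link
  defines "D \<equiv> set ds" and "N1 \<equiv> nbh D - D" and "N2 \<equiv> V - nbh D"
    and "link x y \<equiv> x \<noteq> y \<and> (E x y \<or> (\<exists>v\<in>N2. E x v \<and> E v y))"
  assumes grown: "grown ds"
    and foot: "x \<in> N1 \<Longrightarrow> foot x \<in> D \<and> E x (foot x)"
    and up: "v \<in> N2 \<Longrightarrow> up v \<in> N1 \<and> E v (up v)"
    and second_nb: "x \<in> V \<Longrightarrow> \<exists>w. E x w \<and> w \<noteq> y"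
    and second_up: "v \<in> N2 \<Longrightarrow> \<exists>y\<in>N1. E v y \<and> y \<noteq> x"
    and A_sub: "A \<subseteq> N1"
    and A_indep: "x \<in> A \<Longrightarrow> y \<in> A \<Longrightarrow> \<not> link x y"
    and A_max: "x \<in> N1 - A \<Longrightarrow> \<exists>y\<in>A. link x y"
begin

definition own :: "'a \<Rightarrow> nat" where
  "own x = (if x \<in> A then 0 else 1)"

definition mixed :: "'a \<Rightarrow> bool" where
  "mixed v \<longleftrightarrow> (\<exists>x\<in>A. E v x) \<and> (\<exists>y\<in>N1 - A. E v y)"

definition leg :: "'a \<Rightarrow> 'a \<Rightarrow> nat" where
  "leg x d = (if d = foot x then own x else 1 - own x)"

text \<open>A mixed vertex reaches the two labels by the different colours 2 and 3. At any other
  vertex all upward edges lead to one label; there 4 and 5 provide two differently coloured first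
  steps.\<close>

definition rise :: "'a \<Rightarrow> 'a \<Rightarrow> nat" where
  "rise v x = (if mixed v then 2 + own x else if x = up v then 4 else 5)"

text \<open>
  The colours 0 and 1 are reserved for edges between \<open>D\<close> and \<open>N1\<close>: the edge to the chosen foot
  carries the label, all other edges to \<open>D\<close> the opposite one. Positions of distinct vertices of
  \<open>D\<close> have positive maximum, so edges inside \<open>D\<close> have colours above 5.
\<close>

definition col :: "'a \<Rightarrow> 'a \<Rightarrow> nat" where
  "col u v =
    (if u \<in> D \<and> v \<in> D then 5 + max (position ds u) (position ds v)
     else if v \<in> D then leg u v
     else if u \<in> D then leg v u
     else if u \<in> N1 \<and> v \<in> N1 then 2
     else if v \<in> N1 then rise u v
     else if u \<in> N1 then rise v u
     else 0)"

text \<open>Two vertices with exits in disjoint colour sets below 6 are joined by a rainbow walk: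
  the exits meet \<open>D\<close>, and the connection inside \<open>D\<close> uses colours above 5
  only.\<close>

definition exits :: "'a \<Rightarrow> nat set \<Rightarrow> bool" where
  "exits u C \<longleftrightarrow> (\<exists>d\<in>D. \<exists>cs. cwalk E col u cs d \<and> distinct cs \<and> set cs \<subseteq> C)"

section \<open>Colour sets available for walks into \<open>D\<close>\<close>

lemma col_sym: "col u v = col v u"
  by (auto simp: col_def max.commute)

text \<open>Positions are at most \<open>length ds - 1\<close>. Colour 5 of \<open>rise\<close> also
  fits, since \<open>ds\<close> is nonempty.\<close>

lemma col_less: "col u v < length ds + 5"
proof -
  have len: "0 < length ds" and "distinct ds" using grownD[OF grown] by auto
  then have "position ds w < length ds" if "w \<in> D" for w
    using position_less that by (simp add: D_def)
  then have "u \<in> D \<Longrightarrow> v \<in> D \<Longrightarrow> max (position ds u) (position ds v) < length ds" by simp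
  moreover have "leg x y < length ds + 5" "rise x y < length ds + 5" for x y
    using len by (simp_all add: leg_def rise_def own_def)
  ultimately show ?thesis using len by (simp add: col_def)
qed

lemma exits_mono: "exits u C \<Longrightarrow> C \<subseteq> C' \<Longrightarrow> exits u C'"
  unfolding exits_def by blast

lemma exits_step: "E u w \<Longrightarrow> exits w C \<Longrightarrow> col u w \<notin> C \<Longrightarrow> exits u (insert (col u w) C)"
proof -
  assume *: "E u w" "exits w C" "col u w \<notin> C"
  then obtain d cs where "d \<in> D" "cwalk E col w cs d" "distinct cs" "set cs \<subseteq> C"
    by (auto simp: exits_def)
  with * show ?thesis unfolding exits_def
    by (intro bexI[of _ d] exI[of _ "col u w # cs"]) (auto intro: cwalk.Cons)
qed

lemma exits_D: "u \<in> D \<Longrightarrow> exits u C"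
  unfolding exits_def by (intro bexI[of _ u] exI[of _ "[]"]) (auto intro: cwalk.Nil)

lemma disjoint_layers: "x \<in> N1 \<Longrightarrow> x \<notin> D" "v \<in> N2 \<Longrightarrow> v \<notin> D" "v \<in> N2 \<Longrightarrow> v \<notin> N1"
  by (auto simp: N1_def N2_def nbh_def)

lemma col_leg: "x \<in> N1 \<Longrightarrow> d \<in> D \<Longrightarrow> col x d = leg x d"
  using disjoint_layers(1)[of x] by (simp add: col_def)

lemma col_near: "x \<in> N1 \<Longrightarrow> y \<in> N1 \<Longrightarrow> col x y = 2"
  using disjoint_layers(1)[of x] disjoint_layers(1)[of y] by (simp add: col_def)

lemma col_rise: "v \<in> N2 \<Longrightarrow> x \<in> N1 \<Longrightarrow> col v x = rise v x"
  using disjoint_layers(1)[of x] disjoint_layers(2,3)[of v] by (simp add: col_def)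

lemma exits_own:
  assumes "x \<in> N1"
  shows "exits x {own x}"
  using exits_step[of x "foot x" "{}"] foot[OF assms] exits_D col_leg[OF assms]
  by (simp add: leg_def)

text \<open>This is what the labelling is for: independence of \<open>A\<close> puts every partner
  of a vertex of \<open>A\<close> outside \<open>A\<close>, and maximality gives every other vertex
  a partner in \<open>A\<close>.\<close>

lemma opposite_link:
  assumes "x \<in> N1" "y \<in> N1" "link x y"
  obtains y' where "y' \<in> N1" "link x y'" "own y' = 1 - own x"
proof (cases "x \<in> A")
  case True
  then have "y \<notin> A" using assms(3) A_indep by blast
  then show thesis using assms True by (intro that[of y]) (auto simp: own_def)
next
  case False
  then obtain y' where "y' \<in> A" "link x y'" using A_max assms(1) by blast
  then show thesis using A_sub False by (intro that[of y']) (auto simp: own_def)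
qed

text \<open>A second neighbour \<open>w\<close> of \<open>x\<close> either lies in \<open>D\<close>,
  where its leg has the opposite colour, or makes \<open>x\<close> linked to some vertex of
  \<open>N1\<close>, hence to one of the opposite label, whose own leg is then used.\<close>

lemma exits_opposite:
  assumes x: "x \<in> N1"
  shows "exits x {2, 3, 1 - own x}"
proof -
  have "x \<in> V" using x nbh_subset grownD[OF grown] by (auto simp: N1_def D_def)
  then obtain w where w: "E x w" "w \<noteq> foot x" using second_nb by blast
  show ?thesis
  proof (cases "w \<in> D")
    case True
    then have "exits x {1 - own x}"
      using exits_step[OF w(1) exits_D[OF True, of "{}"]] w(2) col_leg[OF x True] by (simp add: leg_def)
    then show ?thesis by (rule exits_mono) simp
  next
    case False
    have "\<exists>y\<in>N1. link x y"
    proof (cases "w \<in> N1")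
      case True
      with w adj_irrefl[of x] show ?thesis by (intro bexI[of _ w]) (auto simp: link_def)
    next
      case w2: False
      have "w \<in> N2" using w(1) False w2 adj_V[OF adj_sym] by (auto simp: N1_def N2_def)
      with second_up[OF this, of x] w(1) show ?thesis unfolding link_def by metis
    qed
    then obtain y where y: "y \<in> N1" "link x y" "own y = 1 - own x"
      using opposite_link[OF x] by blast
    have own_x: "own x = 0 \<or> own x = 1" by (simp add: own_def)
    show ?thesis
    proof (cases "E x y")
      case True
      have "exits x {2, 1 - own x}"
        using exits_step[OF True exits_own[OF y(1)]] col_near[OF x y(1)] y(3) own_x by auto
      then show ?thesis by (rule exits_mono) auto
    next
      case False
      then obtain v where v: "v \<in> N2" "E x v" "E v y" using y(2) by (auto simp: link_def)
      \<comment> \<open>The middle vertex \<open>v\<close> sees both labels, so its edges to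
        \<open>x\<close> and \<open>y\<close> carry the colours 2 and 3 in some order.\<close>
      have "mixed v"
        using x y v adj_sym unfolding mixed_def own_def by (auto split: if_splits)
      then have c: "col x v = 2 + own x" "col v y = 2 + own y"
        using col_rise[OF v(1)] x y(1) col_sym[of x v] by (auto simp: rise_def)
      have "exits v {2 + own y, own y}"
        using exits_step[OF v(3) exits_own[OF y(1)]] c by simp
      then have "exits x {2 + own x, 2 + own y, own y}"
        using exits_step[OF v(2)] c y(3) own_x by auto
      then show ?thesis by (rule exits_mono) (use y(3) own_x in auto)
    qed
  qed
qed

lemma exits_mixed:
  assumes "v \<in> N2" "mixed v"
  shows "exits v {2, 0}" "exits v {3, 1}"
proof -
  obtain x y where xy: "x \<in> A" "E v x" "y \<in> N1 - A" "E v y"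
    using assms(2) by (auto simp: mixed_def)
  then have N1: "x \<in> N1" "y \<in> N1" using A_sub by auto
  have own: "own x = 0" "own y = 1" using xy by (auto simp: own_def)
  have c: "col v x = 2" "col v y = 3"
    using N1 own assms col_rise by (auto simp: rise_def)
  show "exits v {2, 0}"
    using exits_step[OF xy(2) exits_own[OF N1(1)]] by (simp add: own c)
  show "exits v {3, 1}"
    using exits_step[OF xy(4) exits_own[OF N1(2)]] by (simp add: own c)
qed

text \<open>Both chosen upward edges lead to the label \<open>p\<close>. The third exit avoids
  \<open>p\<close> by taking the detour of \<open>exits_opposite\<close> from the upper end of the
  edge coloured 5.\<close>

lemma exits_pure:
  assumes v: "v \<in> N2" "\<not> mixed v"
  obtains p where "p \<in> {0, 1}" "exits v {4, p}" "exits v {5, p}" "exits v {5, 2, 3, 1 - p}"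
proof -
  obtain y where y: "y \<in> N1" "E v y" "y \<noteq> up v" using second_up[OF v(1)] by blast
  have u: "up v \<in> N1" "E v (up v)" using up[OF v(1)] by auto
  define p where "p = own (up v)"
  have "own y = p" using v u y by (auto simp: mixed_def own_def p_def)
  have p: "p \<in> {0, 1}" by (simp add: p_def own_def)
  have c: "col v (up v) = 4" "col v y = 5"
    using u y v col_rise by (auto simp: rise_def)
  show thesis
  proof (rule that[OF p])
    show "exits v {4, p}" using exits_step[OF u(2) exits_own[OF u(1)]] c p by (auto simp: p_def)
    show "exits v {5, p}" using exits_step[OF y(2) exits_own[OF y(1)]] c p \<open>own y = p\<close> by auto
    show "exits v {5, 2, 3, 1 - p}"
      using exits_step[OF y(2) exits_opposite[OF y(1)]] c p \<open>own y = p\<close> by auto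
  qed
qed

lemma exits_kinds:
  assumes "u \<in> V"
  obtains (core) "\<And>C. exits u C"
  | (near) p where "p \<in> {0, 1}" "exits u {p}" "exits u {2, 3, 1 - p}"
  | (mixed) "exits u {2, 0}" "exits u {3, 1}"
  | (pure) p where "p \<in> {0, 1}" "exits u {4, p}" "exits u {5, p}" "exits u {5, 2, 3, 1 - p}"
proof -
  consider "u \<in> D" | "u \<in> N1" | "u \<in> N2" "mixed u" | "u \<in> N2" "\<not> mixed u"
    using assms by (auto simp: N1_def N2_def)
  then show thesis
  proof cases
    case 1
    then show ?thesis using core exits_D by blast
  next
    case 2
    then show ?thesis using near[of "own u"] exits_own exits_opposite by (simp add: own_def)
  next
    case 3
    then show ?thesis using mixed exits_mixed by blast
  next
    case 4
    then show ?thesis using pure exits_pure by metis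
  qed
qed

text \<open>Clashes occur only between equal labels. Then one vertex takes its detour ending in the
  other label, while a mixed vertex simply picks whichever of its two exits avoids the label of the
  other vertex.\<close>

lemma disjoint_exits:
  assumes "u \<in> V" "v \<in> V"
  shows "\<exists>C C'. exits u C \<and> exits v C' \<and> C \<inter> C' = {} \<and> C \<union> C' \<subseteq> {..5}"
proof -
  have *: ?thesis if "exits u C" "exits v C'" "C \<inter> C' = {}" "C \<union> C' \<subseteq> {..5}" for C C'
    using that by blast
  show ?thesis
  proof (cases rule: exits_kinds[OF assms(1), case_names core near mixed pure])
    case core
    note from_core = *[OF core[of "{}"]]
    show ?thesis
    proof (cases rule: exits_kinds[OF assms(2), case_names core near mixed pure])
      case core
      then show ?thesis using from_core[of "{}"] by simp
    next
      case (near q)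
      then show ?thesis using from_core[of "{q}"] by auto
    next
      case mixed
      then show ?thesis using from_core[of "{2, 0}"] by auto
    next
      case (pure q)
      then show ?thesis using from_core[of "{4, q}"] by auto
    qed
  next
    case (near p)
    show ?thesis
    proof (cases rule: exits_kinds[OF assms(2), case_names core near mixed pure])
      case core
      then show ?thesis using near *[of "{p}" "{}"] by auto
    next
      case (near q)
      then show ?thesis using \<open>p \<in> {0, 1}\<close> \<open>exits u {p}\<close> *[of "{p}" "{2, 3, 1 - q}"] *[of "{p}" "{q}"]
        by (cases "p = q") auto
    next
      case mixed
      then show ?thesis using near *[of "{p}" "{3, 1}"] *[of "{p}" "{2, 0}"] by auto
    next
      case (pure q)
      then show ?thesis using near *[of "{p}" "{5, 2, 3, 1 - q}"] *[of "{p}" "{4, q}"]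
        by (cases "p = q") auto
    qed
  next
    case mixed
    show ?thesis
    proof (cases rule: exits_kinds[OF assms(2), case_names core near mixed pure])
      case core
      then show ?thesis using mixed *[of "{2, 0}" "{}"] by auto
    next
      case (near q)
      then show ?thesis using mixed *[of "{3, 1}" "{q}"] *[of "{2, 0}" "{q}"] by auto
    next
      case m: mixed
      then show ?thesis using mixed *[of "{2, 0}" "{3, 1}"] by auto
    next
      case (pure q)
      then show ?thesis using mixed *[of "{3, 1}" "{4, q}"] *[of "{2, 0}" "{4, q}"] by auto
    qed
  next
    case (pure p)
    show ?thesis
    proof (cases rule: exits_kinds[OF assms(2), case_names core near mixed pure])
      case core
      then show ?thesis using pure *[of "{4, p}" "{}"] by auto
    next
      case (near q)
      then show ?thesis using pure *[of "{5, 2, 3, 1 - p}" "{q}"] *[of "{4, p}" "{q}"]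
        by (cases "p = q") auto
    next
      case mixed
      then show ?thesis using pure *[of "{4, p}" "{3, 1}"] *[of "{4, p}" "{2, 0}"] by auto
    next
      case q: (pure q)
      then show ?thesis using pure *[of "{4, p}" "{5, 2, 3, 1 - q}"] *[of "{4, p}" "{5, q}"]
        by (cases "p = q") auto
    qed
  qed
qed

lemma rainbow_walk:
  assumes "u \<in> V" "v \<in> V"
  shows "\<exists>cs. cwalk E col u cs v \<and> distinct cs"
proof -
  obtain C C' where C: "exits u C" "exits v C'" "C \<inter> C' = {}" "C \<union> C' \<subseteq> {..5}"
    using disjoint_exits[OF assms] by blast
  obtain d cs where d: "d \<in> D" "cwalk E col u cs d" "distinct cs" "set cs \<subseteq> C"
    using C(1) by (auto simp: exits_def)
  obtain d' cs' where d': "d' \<in> D" "cwalk E col v cs' d'" "distinct cs'" "set cs' \<subseteq> C'"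
    using C(2) by (auto simp: exits_def)
  have "distinct ds" using grownD[OF grown] by simp
  then have "\<exists>es. cwalk E col d es d' \<and> distinct es \<and> set es \<subseteq> {5<..<5 + length ds}"
    using d(1) d'(1)
    by (intro grown_rainbow[OF grown col_sym]) (simp_all add: col_def D_def position_nth)
  then obtain es where es: "cwalk E col d es d'" "distinct es" "set es \<subseteq> {5<..<5 + length ds}"
    by blast
  have "cwalk E col u (cs @ es @ rev cs') v"
    using d(2) es(1) cwalk_rev[of E col v cs' d', OF adj_sym col_sym d'(2)] cwalk_append by metis
  moreover have "distinct (cs @ es @ rev cs')"
  proof -
    have "set cs \<inter> set cs' = {}" using C(3) d(4) d'(4) by blast
    moreover have "set cs \<union> set cs' \<subseteq> {..5}" using C(4) d(4) d'(4) by blast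
    ultimately show ?thesis using d(3) d'(3) es(2,3) by fastforce
  qed
  ultimately show ?thesis by blast
qed

end

section \<open>Existence of the two colourings\<close>

context adjacency
begin

lemma rainbow_coloring_of_spanning:
  assumes "grown ds" "set ds = V"
  obtains f :: "'a \<Rightarrow> 'a \<Rightarrow> nat" where "\<And>u v. f u v = f v u"
    "\<And>u v. E u v \<Longrightarrow> f u v \<in> {0<..<card V}"
    "\<And>u v. u \<in> V \<Longrightarrow> v \<in> V \<Longrightarrow> \<exists>cs. cwalk E f u cs v \<and> distinct cs"
proof -
  define f where "f u v = max (position ds u) (position ds v)" for u v
  have ds: "distinct ds" "card V = length ds"
    using grownD[OF assms(1)] assms(2) distinct_card[of ds] by auto
  have sym: "f u v = f v u" for u v by (simp add: f_def max.commute)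
  moreover have "f u v \<in> {0<..<card V}" if "E u v" for u v
  proof -
    have uv: "u \<in> V" "v \<in> V" "u \<noteq> v" using that adj_V adj_sym adj_irrefl by blast+
    then obtain i j where "i < length ds" "j < length ds" "u = ds ! i" "v = ds ! j"
      using assms(2) by (metis in_set_conv_nth)
    \<comment> \<open>The ends of an edge have different positions, so their maximum is positive and
      colour 0 never occurs.\<close>
    moreover from this uv(3) have "i \<noteq> j" by blast
    ultimately show ?thesis using ds by (auto simp: f_def position_nth max_def)
  qed
  moreover have "\<exists>cs. cwalk E f u cs v \<and> distinct cs" if "u \<in> V" "v \<in> V" for u v
  proof -
    have "\<exists>cs. cwalk E f u cs v \<and> distinct cs \<and> set cs \<subseteq> {0<..<0 + length ds}"
      using that assms(2) ds(1) by (intro grown_rainbow[OF assms(1) sym]) (auto simp: f_def position_nth)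
    then show ?thesis by blast
  qed
  ultimately show thesis by (rule that)
qed

lemma rainbow_coloring_of_two_step:
  assumes "grown ds"
    and second_nb: "\<And>x y. x \<in> V \<Longrightarrow> \<exists>w. E x w \<and> w \<noteq> y"
    and second_up: "\<And>v x. v \<in> V - nbh (set ds) \<Longrightarrow> \<exists>y\<in>nbh (set ds). E v y \<and> y \<noteq> x"
  obtains f :: "'a \<Rightarrow> 'a \<Rightarrow> nat" where "\<And>u v. f u v = f v u"
    "\<And>u v. f u v < length ds + 5"
    "\<And>u v. u \<in> V \<Longrightarrow> v \<in> V \<Longrightarrow> \<exists>cs. cwalk E f u cs v \<and> distinct cs"
proof -
  define D where "D = set ds"
  define N1 where "N1 = nbh D - D"
  define N2 where "N2 = V - nbh D"
  define link where "link x y \<longleftrightarrow> x \<noteq> y \<and> (E x y \<or> (\<exists>v\<in>N2. E x v \<and> E v y))" for x y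
  have "finite N1"
    using nbh_subset[of D] grownD[OF assms(1)] finite_V unfolding N1_def D_def
    by (metis finite_Diff finite_subset)
  moreover have "link x y \<Longrightarrow> link y x" for x y
    unfolding link_def using adj_sym by blast
  moreover have "\<not> link x x" for x by (simp add: link_def)
  ultimately obtain A where A: "A \<subseteq> N1" "\<forall>x\<in>A. \<forall>y\<in>A. \<not> link x y" "\<forall>x\<in>N1 - A. \<exists>y\<in>A. link x y"
    using maximal_independent_set[of N1 link] by blast
  have "\<exists>d. x \<in> N1 \<longrightarrow> d \<in> D \<and> E x d" for x
    using adj_sym by (auto simp: N1_def nbh_def)
  then obtain foot where foot: "\<And>x. x \<in> N1 \<Longrightarrow> foot x \<in> D \<and> E x (foot x)"
    by metis
  have up1: "\<exists>y\<in>N1. E v y \<and> y \<noteq> x" if v: "v \<in> N2" for v x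
  proof -
    obtain y where "y \<in> nbh D" "E v y" "y \<noteq> x"
      using second_up v unfolding N2_def D_def by blast
    moreover have "y \<notin> D"
      using v adj_sym[OF \<open>E v y\<close>] by (auto simp: N2_def nbh_def)
    ultimately show ?thesis by (auto simp: N1_def)
  qed
  then have "\<exists>y. v \<in> N2 \<longrightarrow> y \<in> N1 \<and> E v y" for v by blast
  then obtain up where up: "\<And>v. v \<in> N2 \<Longrightarrow> up v \<in> N1 \<and> E v (up v)"
    by metis
  interpret two_step V E ds A foot up D N1 N2 link
    by unfold_locales
      (use assms(1) second_nb foot up up1 A in \<open>simp_all add: D_def N1_def N2_def link_def\<close>)
  show thesis using that[of col] col_sym col_less rainbow_walk by blast
qed

end

section \<open>Bounds for the rainbow connection number\<close>

context graph
begin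

section \<open>Transfer from adjacency relations to graphs\<close>

lemma adjacency_dominates: "adjacency (verts G) (dominates G)"
  by unfold_locales
    (auto dest: adj_in_verts adj_not_same intro: arcs_ends_symmetric[OF sym_arcs])

lemma card_dominated: "card {w. u \<rightarrow>\<^bsub>G\<^esub> w} = out_degree G u"
proof -
  have "{w. u \<rightarrow>\<^bsub>G\<^esub> w} = head G ` out_arcs G u" by (auto simp: arcs_ends_conv out_arcs_def)
  moreover have "inj_on (head G) (out_arcs G u)"
    by (rule inj_onI) (auto intro!: no_multi_arcs simp: arc_to_ends_def)
  ultimately show ?thesis by (simp add: card_image out_degree_def)
qed

lemma min_degree_le: "v \<in> verts G \<Longrightarrow> min_degree G \<le> out_degree G v"
  by (simp add: min_degree_def)

lemma uedges_dominates: "e \<in> uedges G \<Longrightarrow> \<exists>u v. u \<rightarrow>\<^bsub>G\<^esub> v \<and> e = {u, v}"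
  by (auto simp: uedges_def uedge_def arcs_ends_conv)

lemma awalk_of_cwalk:
  assumes "\<And>x y. c {x, y} = f x y"
  shows "cwalk (dominates G) f u cs v \<Longrightarrow> u \<in> verts G \<Longrightarrow>
    \<exists>p. awalk u p v \<and> map (\<lambda>a. c (uedge G a)) p = cs"
proof (induction rule: cwalk.induct)
  case (Cons u w cs v)
  then obtain p where p: "awalk w p v" "map (\<lambda>a. c (uedge G a)) p = cs"
    using adj_in_verts by blast
  obtain a where "a \<in> arcs G" "tail G a = u" "head G a = w"
    using \<open>u \<rightarrow>\<^bsub>G\<^esub> w\<close> by blast
  with p assms show ?case
    by (intro exI[of _ "a # p"]) (auto simp: awalk_Cons_iff uedge_def)
qed (auto simp: awalk_Nil_iff)

text \<open>Shortcutting keeps a subset of the arcs, on which the colouring stays injective, and a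
  path repeats no arc.\<close>

lemma rainbow_path_of_awalk:
  assumes "awalk u p v" "distinct (map (\<lambda>a. c (uedge G a)) p)"
  shows "\<exists>q. rainbow_path G c u q v"
proof -
  have q: "apath u (awalk_to_apath p) v" "set (awalk_to_apath p) \<subseteq> set p"
    using assms(1) apath_awalk_to_apath awalk_to_apath_subset by blast+
  then have "distinct (awalk_to_apath p)"
    unfolding apath_def using distinct_verts_imp_distinct by blast
  with q assms(2) have "distinct (map (\<lambda>a. c (uedge G a)) (awalk_to_apath p))"
    by (auto simp: distinct_map intro: inj_on_subset)
  with q(1) show ?thesis unfolding rainbow_path_def by blast
qed

lemma rainbow_connected_of_cwalks:
  assumes "\<And>u v. f u v = f v u"
    and "\<And>u v. u \<in> verts G \<Longrightarrow> v \<in> verts G \<Longrightarrow> \<exists>cs. cwalk (dominates G) f u cs v \<and> distinct cs"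
  obtains c where "rainbow_connected G c" "\<And>u v. c {u, v} = f u v"
proof -
  obtain c where c: "\<And>u v. c {u, v} = f u v"
    using symmetric_edge_function[of f] assms(1) by blast
  have "\<exists>q. rainbow_path G c u q v" if uv: "u \<in> verts G" "v \<in> verts G" for u v
  proof -
    obtain cs where "cwalk (dominates G) f u cs v" "distinct cs" using assms(2)[OF uv] by blast
    then obtain p where "awalk u p v" "map (\<lambda>a. c (uedge G a)) p = cs"
      using awalk_of_cwalk[of c f u cs v] c uv(1) by blast
    with \<open>distinct cs\<close> rainbow_path_of_awalk show ?thesis by metis
  qed
  then show thesis using that c unfolding rainbow_connected_def by blast
qed

lemma rc_le_card:
  fixes c :: "'a set \<Rightarrow> nat"
  assumes "rainbow_connected G c" "\<And>u v. u \<rightarrow>\<^bsub>G\<^esub> v \<Longrightarrow> c {u, v} \<in> B" "finite B"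
  shows "rc G \<le> card B"
proof -
  have "rc G \<le> card (c ` uedges G)"
    unfolding rc_def using assms(1) by (intro Least_le) blast
  also have "c ` uedges G \<subseteq> B" using assms(2) uedges_dominates by blast
  then have "card (c ` uedges G) \<le> card B" using assms(3) by (rule card_mono[rotated])
  finally show ?thesis .
qed

text \<open>A set that no arc leaves contains everything reachable from it.\<close>

lemma connected_cut:
  assumes "Digraph_Component.connected G" "S \<subseteq> verts G" "S \<noteq> {}" "S \<noteq> verts G"
  shows "\<exists>p\<in>S. \<exists>q\<in>verts G - S. p \<rightarrow>\<^bsub>G\<^esub> q"
proof (rule ccontr)
  assume no: "\<not> ?thesis"
  obtain s t where st: "s \<in> S" "t \<in> verts G" "t \<notin> S" using assms by blast
  have "s \<rightarrow>\<^sup>* t"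
    using symmetric_connected_imp_strongly_connected[OF sym_arcs assms(1)] st assms(2)
    by (auto simp: strongly_connected_def)
  then have "t \<in> S"
  proof (induction rule: reachable_induct)
    case (step x y)
    with no adj_in_verts(2) show ?case by blast
  qed (use st in blast)
  with st show False by simp
qed

lemma connected_nonempty: "Digraph_Component.connected G \<Longrightarrow> verts G \<noteq> {}"
  by (simp add: connected_conv)

lemma rainbow_connected_spanning:
  assumes "Digraph_Component.connected G"
  obtains c :: "'a set \<Rightarrow> nat" where "rainbow_connected G c" "\<And>u v. u \<rightarrow>\<^bsub>G\<^esub> v \<Longrightarrow> c {u, v} \<in> {0<..<card (verts G)}"
proof -
  interpret adjacency "verts G" "dominates G" by (rule adjacency_dominates)
  obtain ds where "grown ds" "set ds = verts G"
    using grown_spanning[OF connected_nonempty connected_cut] assms by blast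
  then obtain f :: "'a \<Rightarrow> 'a \<Rightarrow> nat" where f: "\<And>u v. f u v = f v u"
    "\<And>u v. u \<rightarrow>\<^bsub>G\<^esub> v \<Longrightarrow> f u v \<in> {0<..<card (verts G)}"
    "\<And>u v. u \<in> verts G \<Longrightarrow> v \<in> verts G \<Longrightarrow> \<exists>cs. cwalk (dominates G) f u cs v \<and> distinct cs"
    using rainbow_coloring_of_spanning by blast
  obtain c where "rainbow_connected G c" "\<And>u v. c {u, v} = f u v"
    using rainbow_connected_of_cwalks[OF f(1,3)] by blast
  with f(2) show thesis by (intro that[of c]) simp_all
qed

lemma rc_le_order:
  assumes "Digraph_Component.connected G"
  shows "rc G \<le> card (verts G)"
proof -
  obtain c :: "'a set \<Rightarrow> nat" where "rainbow_connected G c" "\<And>u v. u \<rightarrow>\<^bsub>G\<^esub> v \<Longrightarrow> c {u, v} \<in> {0<..<card (verts G)}"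
    using rainbow_connected_spanning[OF assms] by blast
  then have "rc G \<le> card {0<..<card (verts G)}" by (intro rc_le_card[of c]) auto
  then show ?thesis by simp
qed

lemma rc_le_min_degree:
  assumes conn: "Digraph_Component.connected G" and "2 \<le> min_degree G"
  shows "rc G * (min_degree G + 1) \<le> 3 * card (verts G) + 3 * (min_degree G + 1)"
proof -
  interpret adjacency "verts G" "dominates G" by (rule adjacency_dominates)
  have deg: "min_degree G \<le> card {w. v \<rightarrow>\<^bsub>G\<^esub> w}" if "v \<in> verts G" for v
    using min_degree_le[OF that] by (simp add: card_dominated)
  obtain ds where ds: "grown ds" "(length ds + 2) * (min_degree G + 1) \<le> 3 * card (verts G)"
    "\<And>v x. v \<in> verts G - nbh (set ds) \<Longrightarrow> \<exists>y\<in>nbh (set ds). v \<rightarrow>\<^bsub>G\<^esub> y \<and> y \<noteq> x"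
    using greedy_two_step_dominating[OF connected_nonempty[OF conn] connected_cut[OF conn] deg assms(2)]
    by blast
  have second: "\<exists>w. x \<rightarrow>\<^bsub>G\<^esub> w \<and> w \<noteq> y" if "x \<in> verts G" for x y
  proof (rule ccontr)
    assume "\<not> ?thesis"
    then have "{w. x \<rightarrow>\<^bsub>G\<^esub> w} \<subseteq> {y}" by blast
    then have "card {w. x \<rightarrow>\<^bsub>G\<^esub> w} \<le> card {y}" by (rule card_mono[rotated]) simp
    with deg[OF that] assms(2) show False by simp
  qed
  obtain f :: "'a \<Rightarrow> 'a \<Rightarrow> nat" where f: "\<And>u v. f u v = f v u" "\<And>u v. f u v < length ds + 5"
    "\<And>u v. u \<in> verts G \<Longrightarrow> v \<in> verts G \<Longrightarrow> \<exists>cs. cwalk (dominates G) f u cs v \<and> distinct cs"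
    using rainbow_coloring_of_two_step[OF ds(1) second ds(3)] by blast
  obtain c where "rainbow_connected G c" "\<And>u v. c {u, v} = f u v"
    using rainbow_connected_of_cwalks[OF f(1,3)] by blast
  then have "rc G \<le> card {..<length ds + 5}"
    using f(2) by (intro rc_le_card[of c]) auto
  \<comment> \<open>The 5 is split as 2 + 3: the greedy bound absorbs |D| + 2, and the 3 remains as
    the additive constant of the theorem.\<close>
  then have "rc G * (min_degree G + 1) \<le> (length ds + 2 + 3) * (min_degree G + 1)"
    by (intro mult_right_mono) auto
  also have "\<dots> \<le> 3 * card (verts G) + 3 * (min_degree G + 1)"
    using ds(2) by (simp only: add_mult_distrib)
  finally show ?thesis .
qed

lemma rc_upper_bound:
  assumes "Digraph_Component.connected G"
  shows "real (rc G) \<le> 3 * real (card (verts G)) / (real (min_degree G) + 1) + 3"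
proof (cases "2 \<le> min_degree G")
  case True
  have "real (rc G * (min_degree G + 1)) \<le> real (3 * card (verts G) + 3 * (min_degree G + 1))"
    using rc_le_min_degree[OF assms True] by (rule of_nat_mono)
  then show ?thesis by (simp add: field_simps)
next
  case False
  \<comment> \<open>Here \<delta> + 1 \<le> 2, so n is already at most 3 n / (\<delta> + 1).\<close>
  then have "real (card (verts G)) * (real (min_degree G) + 1) \<le> real (card (verts G)) * 3"
    by (intro mult_left_mono) auto
  then have "real (card (verts G)) \<le> 3 * real (card (verts G)) / (real (min_degree G) + 1)"
    by (simp add: field_simps)
  with rc_le_order[OF assms] show ?thesis by linarith
qed

text \<open>\<open>lay\<close> rises by at most 1 along an arc, so a path from \<open>u\<close> to
  \<open>v\<close> has at least \<open>lay v - lay u\<close> arcs; on a rainbow path all their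
  colours differ.\<close>

lemma rc_lower_bound:
  assumes "Digraph_Component.connected G"
    and lay: "\<And>x y. x \<rightarrow>\<^bsub>G\<^esub> y \<Longrightarrow> lay y \<le> lay x + (1 :: nat)"
    and uv: "u \<in> verts G" "v \<in> verts G"
  shows "lay v \<le> lay u + rc G"
proof -
  \<comment> \<open>\<open>LEAST\<close> is attained only once some rainbow colouring is known to
    exist.\<close>
  obtain c' :: "'a set \<Rightarrow> nat" where "rainbow_connected G c'"
    by (rule rainbow_connected_spanning[OF assms(1)])
  then have "\<exists>k. \<exists>c :: 'a set \<Rightarrow> nat. card (c ` uedges G) = k \<and> rainbow_connected G c"
    by (intro exI[of _ "card (c' ` uedges G)"] exI[of _ c'] conjI refl)
  from LeastI_ex[OF this] obtain c :: "'a set \<Rightarrow> nat"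
    where c: "card (c ` uedges G) = rc G" "rainbow_connected G c"
    unfolding rc_def by blast
  then obtain p where p: "apath u p v" "distinct (map (\<lambda>a. c (uedge G a)) p)"
    using uv unfolding rainbow_connected_def rainbow_path_def by blast
  then have walk: "awalk u p v" by (simp add: apath_def)
  have "lay v \<le> lay u + length p"
    using walk
  proof (induction p arbitrary: u)
    case (Cons a p)
    then have "tail G a \<rightarrow>\<^bsub>G\<^esub> head G a" "u = tail G a" "lay v \<le> lay (head G a) + length p"
      by (auto simp: awalk_Cons_iff in_arcs_imp_in_arcs_ends)
    with lay[of "tail G a" "head G a"] show ?case by simp
  qed (simp add: awalk_Nil_iff)
  also have "length p = card (set (map (\<lambda>a. c (uedge G a)) p))"
    using distinct_card[OF p(2)] by simp
  also have "\<dots> \<le> card (c ` uedges G)"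
    using walk by (intro card_mono) (auto simp: uedges_def awalk_def)
  finally show ?thesis using c(1) by simp
qed

end

section \<open>Chains of cliques\<close>

text \<open>
  Block \<open>q < K\<close> consists of the vertices \<open>q (d + 1) + r\<close> with \<open>r \<le> d\<close> and occupies the layers
  \<open>3 q\<close>, \<open>3 q + 1\<close>, \<open>3 q + 2\<close>. The last two vertices enlarge the middle layers of the first and the
  last block, so that the ends of the chain have degree \<open>d\<close>.
\<close>

definition layer :: "nat \<Rightarrow> nat \<Rightarrow> nat \<Rightarrow> nat" where
  "layer d K u =
    (if u = K * (d + 1) then 1
     else if u = K * (d + 1) + 1 then 3 * K - 2
     else 3 * (u div (d + 1)) +
       (if u mod (d + 1) = 0 then 0 else if u mod (d + 1) = d then 2 else 1))"

definition layered :: "nat \<Rightarrow> nat \<Rightarrow> (nat, nat \<times> nat) pre_digraph" where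
  "layered d K = \<lparr> verts = {..<K * (d + 1) + 2},
     arcs = {(u, v). u < K * (d + 1) + 2 \<and> v < K * (d + 1) + 2 \<and> u \<noteq> v \<and>
       layer d K u \<le> layer d K v + 1 \<and> layer d K v \<le> layer d K u + 1},
     tail = fst, head = snd \<rparr>"

lemma verts_layered [simp]: "verts (layered d K) = {..<K * (d + 1) + 2}"
  by (simp add: layered_def)

lemma dominates_layered:
  "u \<rightarrow>\<^bsub>layered d K\<^esub> v \<longleftrightarrow> u < K * (d + 1) + 2 \<and> v < K * (d + 1) + 2 \<and> u \<noteq> v \<and>
     layer d K u \<le> layer d K v + 1 \<and> layer d K v \<le> layer d K u + 1"
  by (auto simp: layered_def arcs_ends_conv)

lemma graph_layered: "graph (layered d K)"
proof
  show "finite (arcs (layered d K))"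
    by (rule finite_subset[of _ "{..<K * (d + 1) + 2} \<times> {..<K * (d + 1) + 2}"])
      (auto simp: layered_def)
  show "symmetric (layered d K)"
    unfolding symmetric_def sym_def using dominates_layered by auto
qed (auto simp: layered_def arc_to_ends_def)

text \<open>Used to tell chains of different lengths apart.\<close>

lemma digraph_iso_card_verts: "digraph_iso G H \<Longrightarrow> card (verts H) = card (verts G)"
  by (auto simp: digraph_iso_def pre_digraph.digraph_isomorphism_def card_image)

locale layered_graph =
  fixes d K :: nat
  assumes d: "2 \<le> d" and K: "2 \<le> K"
begin

abbreviation "G \<equiv> layered d K"

definition vtx :: "nat \<Rightarrow> nat \<Rightarrow> nat" where
  "vtx q r = q * (d + 1) + r"

lemma vtx_less: "q < K \<Longrightarrow> r \<le> d \<Longrightarrow> vtx q r < K * (d + 1)"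
proof -
  assume "q < K" "r \<le> d"
  then have "q * (d + 1) + r < (q + 1) * (d + 1)" by simp
  also have "\<dots> \<le> K * (d + 1)" using \<open>q < K\<close> by (intro mult_right_mono) auto
  finally show ?thesis by (simp add: vtx_def)
qed

lemma vtx_cases:
  assumes "u < K * (d + 1) + 2"
  obtains q r where "q < K" "r \<le> d" "u = vtx q r" | "u = K * (d + 1)" | "u = K * (d + 1) + 1"
proof (cases "u < K * (d + 1)")
  case True
  then have "u div (d + 1) < K" by (simp add: less_mult_imp_div_less)
  moreover have "u mod (d + 1) \<le> d" using mod_less_divisor[of "d + 1" u] by linarith
  moreover have "u = vtx (u div (d + 1)) (u mod (d + 1))" by (simp only: vtx_def div_mult_mod_eq)
  ultimately show thesis by (rule that)
next
  case False
  with assms that show thesis by linarith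
qed

lemma layer_vtx:
  assumes "q < K" "r \<le> d"
  shows "layer d K (vtx q r) = 3 * q + (if r = 0 then 0 else if r = d then 2 else 1)"
proof -
  have "vtx q r div (d + 1) = q" "vtx q r mod (d + 1) = r"
    using assms(2) by (simp_all add: vtx_def div_mult_self3 mod_mult_self3 del: mult_Suc_right)
  then show ?thesis using vtx_less[OF assms] unfolding layer_def by simp
qed

lemma layer_extra: "layer d K (K * (d + 1)) = 1" "layer d K (K * (d + 1) + 1) = 3 * K - 2"
  by (simp_all add: layer_def)

lemma dominates_I:
  "u < K * (d + 1) + 2 \<Longrightarrow> v < K * (d + 1) + 2 \<Longrightarrow> u \<noteq> v \<Longrightarrow>
    layer d K u \<le> layer d K v + 1 \<Longrightarrow> layer d K v \<le> layer d K u + 1 \<Longrightarrow> u \<rightarrow>\<^bsub>G\<^esub> v"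
  by (simp add: dominates_layered)

lemma inj_vtx: "inj_on (vtx q) S"
  by (auto simp: vtx_def inj_on_def)

lemma card_inner: "w \<notin> vtx q ` {1..<d} \<Longrightarrow> card (insert w (vtx q ` {1..<d})) = d"
  using d by (simp add: card_image inj_vtx)

text \<open>An inner vertex sees the other d vertices of its block. An end of a block sees the d - 1
  inner ones and one more, \<open>w\<close>: the facing end of the adjacent block or, at an end of
  the chain, an extra vertex.\<close>

lemma many_dominated:
  assumes "u < K * (d + 1) + 2"
  shows "\<exists>T. T \<subseteq> {w. u \<rightarrow>\<^bsub>G\<^esub> w} \<and> card T = d"
  using assms
proof (cases rule: vtx_cases)
  case (1 q r)
  have less: "vtx q s < K * (d + 1)" if "s \<le> d" for s using 1(1) that by (rule vtx_less)
  note lay = layer_vtx[OF 1(1)]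
  consider "r = 0" | "r = d" | "0 < r" "r < d" using 1(2) by linarith
  then show ?thesis
  proof cases
    case r: 1
    define w where "w = (if q = 0 then K * (d + 1) else vtx (q - 1) d)"
    have w: "w < K * (d + 1) + 2 \<and> layer d K w \<le> 3 * q + 1 \<and> 3 * q \<le> layer d K w + 1"
    proof (cases "q = 0")
      case False
      have "q - 1 < K" using 1(1) by simp
      with False show ?thesis
        using vtx_less[of "q - 1" d] layer_vtx[of "q - 1" d] d by (auto simp: w_def)
    qed (use layer_extra in \<open>simp add: w_def\<close>)
    have ne: "w \<noteq> vtx q s" if "s \<le> d" for s
      using less[OF that] by (cases q) (auto simp: w_def vtx_def)
    have "u \<rightarrow>\<^bsub>G\<^esub> w"
      using w less[of 0] lay[of 0] ne[of 0] r 1 by (intro dominates_I) auto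
    moreover have "u \<rightarrow>\<^bsub>G\<^esub> vtx q s" if "s \<in> {1..<d}" for s
      using less[of 0] less[of s] lay[of 0] lay[of s] that r 1 by (intro dominates_I) (auto simp: vtx_def)
    moreover have "card (insert w (vtx q ` {1..<d})) = d"
      by (rule card_inner) (use ne in \<open>metis imageE atLeastLessThan_iff less_imp_le\<close>)
    ultimately show ?thesis by (intro exI[of _ "insert w (vtx q ` {1..<d})"]) auto
  next
    case r: 2
    define w where "w = (if q = K - 1 then K * (d + 1) + 1 else vtx (q + 1) 0)"
    have w: "w < K * (d + 1) + 2 \<and> layer d K w \<le> 3 * q + 3 \<and> 3 * q + 1 \<le> layer d K w"
    proof (cases "q = K - 1")
      case False
      then have "q + 1 < K" using 1(1) by simp
      with False show ?thesis
        using vtx_less[of "q + 1" 0] layer_vtx[of "q + 1" 0] by (simp add: w_def)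
    qed (use layer_extra K in \<open>auto simp add: w_def\<close>)
    have ne: "w \<noteq> vtx q s" if "s \<le> d" for s
      using less[OF that] that by (cases "q = K - 1") (auto simp: w_def vtx_def)
    have "u \<rightarrow>\<^bsub>G\<^esub> w"
      using w less[of d] lay[of d] ne[of d] r 1 d by (intro dominates_I) auto
    moreover have "u \<rightarrow>\<^bsub>G\<^esub> vtx q s" if "s \<in> {1..<d}" for s
      using less[of d] less[of s] lay[of d] lay[of s] that r 1 by (intro dominates_I) (auto simp: vtx_def)
    moreover have "card (insert w (vtx q ` {1..<d})) = d"
      by (rule card_inner) (use ne in \<open>metis imageE atLeastLessThan_iff less_imp_le\<close>)
    ultimately show ?thesis by (intro exI[of _ "insert w (vtx q ` {1..<d})"]) auto
  next
    case r: 3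
    have "u \<rightarrow>\<^bsub>G\<^esub> vtx q s" if "s \<le> d" "s \<noteq> r" for s
      using less[of r] less[of s] lay[of r] lay[of s] that r 1 by (intro dominates_I) (auto simp: vtx_def)
    moreover have "card (vtx q ` ({..d} - {r})) = d"
      using r by (simp add: card_image inj_vtx)
    ultimately show ?thesis by (intro exI[of _ "vtx q ` ({..d} - {r})"]) auto
  qed
next
  case 2
  have "u \<rightarrow>\<^bsub>G\<^esub> vtx 0 r" if "r < d" for r
    using 2 that K vtx_less[of 0 r] layer_vtx[of 0 r] layer_extra by (intro dominates_I) auto
  moreover have "card (vtx 0 ` {..<d}) = d" by (simp add: card_image inj_vtx)
  ultimately show ?thesis by (intro exI[of _ "vtx 0 ` {..<d}"]) auto
next
  case 3
  have "u \<rightarrow>\<^bsub>G\<^esub> vtx (K - 1) r" if "1 \<le> r" "r \<le> d" for r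
    using 3 that K vtx_less[of "K - 1" r] layer_vtx[of "K - 1" r] layer_extra
    by (intro dominates_I) auto
  moreover have "card (vtx (K - 1) ` {1..d}) = d" by (simp add: card_image inj_vtx)
  ultimately show ?thesis by (intro exI[of _ "vtx (K - 1) ` {1..d}"]) auto
qed

text \<open>Vertex 0 is alone in layer 0, so only layer 1 is left: the inner vertices of the first
  block and its extra vertex. Degree d is thus attained.\<close>

lemma dominated_zero: "{w. 0 \<rightarrow>\<^bsub>G\<^esub> w} \<subseteq> insert (K * (d + 1)) (vtx 0 ` {1..<d})"
proof
  fix w assume "w \<in> {w. 0 \<rightarrow>\<^bsub>G\<^esub> w}"
  then have w: "w < K * (d + 1) + 2" "w \<noteq> 0" "layer d K w \<le> 1"
    using layer_vtx[of 0 0] K by (auto simp: dominates_layered vtx_def)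
  from w(1) show "w \<in> insert (K * (d + 1)) (vtx 0 ` {1..<d})"
  proof (cases rule: vtx_cases)
    case (1 q r)
    with w d layer_vtx[of q r] have "q = 0" "r \<noteq> d" by (auto split: if_splits)
    with 1 w show ?thesis by (auto simp: vtx_def)
  next
    case 3
    with w layer_extra K show ?thesis by simp
  qed simp
qed

lemma min_degree_layered: "min_degree G = d"
proof -
  interpret graph G by (rule graph_layered)
  have fin: "finite {w. u \<rightarrow>\<^bsub>G\<^esub> w}" for u
    by (rule finite_subset[of _ "{..<K * (d + 1) + 2}"]) (auto simp: dominates_layered)
  have "d \<le> out_degree G u" if "u \<in> verts G" for u
    using that many_dominated[of u] card_mono[OF fin] unfolding card_dominated[symmetric] by auto
  moreover have "out_degree G 0 \<le> d"
  proof -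
    have "card {w. 0 \<rightarrow>\<^bsub>G\<^esub> w} \<le> card (insert (K * (d + 1)) (vtx 0 ` {1..<d}))"
      by (rule card_mono[OF _ dominated_zero]) simp
    also have "\<dots> = d"
    proof (rule card_inner)
      show "K * (d + 1) \<notin> vtx 0 ` {1..<d}"
      proof
        assume "K * (d + 1) \<in> vtx 0 ` {1..<d}"
        then obtain r where "r < d" "K * (d + 1) = vtx 0 r" by auto
        with vtx_less[of 0 r] K show False by simp
      qed
    qed
    finally show ?thesis by (simp add: card_dominated)
  qed
  ultimately show ?thesis
    unfolding min_degree_def by (intro Min_eqI) (auto intro!: image_eqI[of _ _ 0] antisym)
qed

lemma reachable_zero:
  assumes "u < K * (d + 1) + 2"
  shows "u \<rightarrow>\<^sup>*\<^bsub>G\<^esub> 0"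
proof -
  interpret graph G by (rule graph_layered)
  have zero: "0 \<rightarrow>\<^sup>*\<^bsub>G\<^esub> 0" by simp
  have main: "u \<rightarrow>\<^sup>*\<^bsub>G\<^esub> 0" if "u < K * (d + 1)" for u
    using that
  proof (induction u)
    case (Suc u)
    have "Suc u < K * (d + 1) + 2" using Suc.prems by simp
    \<comment> \<open>Consecutive numbers below \<open>K * (d + 1)\<close> lie in equal or adjacent
      layers, so one can count down to 0.\<close>
    then have "Suc u \<rightarrow>\<^bsub>G\<^esub> u"
    proof (cases rule: vtx_cases)
      case (1 q r)
      \<comment> \<open>Block coordinates of \<open>u\<close>; for \<open>r = 0\<close> it is the
        last vertex of the preceding block.\<close>
      define q' r' where "q' = (if r = 0 then q - 1 else q)" and "r' = (if r = 0 then d else r - 1)"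
      have "q' < K" "r' \<le> d" "u = vtx q' r'"
        using 1 by (cases q; auto simp: q'_def r'_def vtx_def)+
      moreover have "r = 0 \<Longrightarrow> 0 < q" using 1 by (cases q) (auto simp: vtx_def)
      ultimately show ?thesis
        using Suc.prems 1 d layer_vtx[of q r] layer_vtx[of q' r']
        by (intro dominates_I) (auto simp: q'_def r'_def split: if_splits)
    qed (use Suc.prems in auto)
    with Suc show ?case by (auto intro: adj_reachable_trans)
  qed (rule zero)
  from assms show ?thesis
  proof (cases rule: vtx_cases)
    case (1 q r)
    then show ?thesis using main vtx_less by blast
  next
    case 2
    have "u \<rightarrow>\<^bsub>G\<^esub> 0"
      using 2 K layer_vtx[of 0 0] layer_extra by (intro dominates_I) (auto simp: vtx_def)
    then show ?thesis by (rule reachable_adjI)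
  next
    case 3
    have "u \<rightarrow>\<^bsub>G\<^esub> vtx (K - 1) d"
      using 3 K d layer_vtx[of "K - 1" d] vtx_less[of "K - 1" d] layer_extra
      by (intro dominates_I) auto
    then show ?thesis
      using main[of "vtx (K - 1) d"] vtx_less[of "K - 1" d] K by (auto intro: adj_reachable_trans)
  qed
qed

lemma connected_layered: "Digraph_Component.connected G"
proof -
  interpret graph G by (rule graph_layered)
  have "u \<rightarrow>\<^sup>*\<^bsub>G\<^esub> v" if "u \<in> verts G" "v \<in> verts G" for u v
    using that reachable_zero symmetric_reachable' reachable_trans by (metis lessThan_iff verts_layered)
  then have "u \<rightarrow>\<^sup>*\<^bsub>mk_symmetric G\<^esub> v" if "u \<in> verts G" "v \<in> verts G" for u v
    using that reachable_mk_symmetric_eq[OF sym_arcs] by blast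
  then show ?thesis
    unfolding Digraph_Component.connected_def strongly_connected_def by auto
qed

lemma rc_layered: "3 * K - 1 \<le> rc G"
proof -
  interpret graph G by (rule graph_layered)
  have "layer d K (vtx (K - 1) d) \<le> layer d K (vtx 0 0) + rc G"
    using vtx_less[of "K - 1" d] vtx_less[of 0 0] K
    by (intro rc_lower_bound connected_layered) (auto simp: dominates_layered)
  then show ?thesis using layer_vtx[of "K - 1" d] layer_vtx[of 0 0] K d by auto
qed

text \<open>As n - 2 = K (d + 1), the left side is exactly 3 K - 1.\<close>

lemma rc_layered_real:
  "3 * (real (card (verts G)) - 2) / (real d + 1) - 1 \<le> real (rc G)"
proof -
  have "real (card (verts G)) - 2 = real K * (real d + 1)" by (simp add: algebra_simps)
  then have "3 * (real (card (verts G)) - 2) / (real d + 1) - 1 = 3 * real K - 1" by simp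
  also have "\<dots> \<le> real (rc G)" using rc_layered K by linarith
  finally show ?thesis .
qed

end

theorem theorem7:
  shows
    "(\<forall>G :: ('a, 'b) pre_digraph. graph G \<and> Digraph_Component.connected G \<longrightarrow>
        real (rc G) \<le> 3 * real (card (verts G)) / (real (min_degree G) + 1) + 3) \<and>
     (\<forall>\<delta>::nat. \<delta> \<ge> 2 \<longrightarrow>
        (\<exists>\<G> :: (nat, nat \<times> nat) pre_digraph set.
           infinite \<G> \<and> pairwise (\<lambda>G H. \<not> digraph_iso G H) \<G> \<and>
           (\<forall>G \<in> \<G>. graph G \<and> Digraph_Component.connected G \<and> min_degree G = \<delta> \<and>
              real (rc G) \<ge> 3 * (real (card (verts G)) - 2) / (real \<delta> + 1) - 1)))"
proof (intro conjI allI impI)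
  fix G :: "('a, 'b) pre_digraph"
  assume "graph G \<and> Digraph_Component.connected G"
  then show "real (rc G) \<le> 3 * real (card (verts G)) / (real (min_degree G) + 1) + 3"
    using graph.rc_upper_bound by blast
next
  fix \<delta> :: nat
  assume \<delta>: "\<delta> \<ge> 2"
  \<comment> \<open>The order determines the number of blocks; this yields both infinitely many
    graphs and pairwise non-isomorphism.\<close>
  have card_eq: "K = L" if "card (verts (layered \<delta> K)) = card (verts (layered \<delta> L))" for K L
  proof -
    have "K * (\<delta> + 1) = L * (\<delta> + 1)"
      using that by (simp only: verts_layered card_lessThan add_right_cancel)
    then show ?thesis by (simp only: mult_cancel2) simp
  qed
  then have "inj_on (layered \<delta>) {2..}" by (metis inj_onI)
  then have "infinite (layered \<delta> ` {2..})" using infinite_Ici finite_imageD by blast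
  moreover have "pairwise (\<lambda>G H. \<not> digraph_iso G H) (layered \<delta> ` {2..})"
    unfolding pairwise_def using card_eq digraph_iso_card_verts by (metis imageE)
  moreover have "graph G \<and> Digraph_Component.connected G \<and> min_degree G = \<delta> \<and>
      real (rc G) \<ge> 3 * (real (card (verts G)) - 2) / (real \<delta> + 1) - 1"
    if "G \<in> layered \<delta> ` {2..}" for G
  proof -
    from that obtain K where *: "2 \<le> K" "G = layered \<delta> K" by auto
    interpret layered_graph \<delta> K using \<delta> *(1) by unfold_locales
    show ?thesis
      using graph_layered connected_layered min_degree_layered rc_layered_real *(2) by blast
  qed
  ultimately show "\<exists>\<G> :: (nat, nat \<times> nat) pre_digraph set.
           infinite \<G> \<and> pairwise (\<lambda>G H. \<not> digraph_iso G H) \<G> \<and>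
           (\<forall>G \<in> \<G>. graph G \<and> Digraph_Component.connected G \<and> min_degree G = \<delta> \<and>
              real (rc G) \<ge> 3 * (real (card (verts G)) - 2) / (real \<delta> + 1) - 1)"
    by blast
qed

end
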